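(* Let $\mathcal{A}\subset\mathbb{N}$ be an infinite set such that $$E(A_N)\ll N^3\psi(N),$$ where $\psi:\mathbb{N}\to[0,1]$ is a weakly decreasing function such that the series $\sum_{N}\psi(N)/N$ converges. Then $\mathcal{A}$ has doubly metric Poissonian pair correlations; that is, for Lebesgue-almost every pair $(\alpha,\gamma)\in\mathbb{T}^2$ one has $\lim_{N\to\infty}F(\alpha,\gamma,s,N,\mathcal{A})=2s$ for every real $s>0$.
   Context: $\mathbb{N}=\{1,2,3,\dots\}$, $\mathbb{T}=\mathbb{R}/\mathbb{Z}$, $\|\cdot\|$ denotes distance to $0$ in $\mathbb{T}$, and $[N]=\{1,\dots,N\}$. For an infinite set $\mathcal{A}\subset\mathbb{N}$, enumerate its elements in increasing order as $a_1<a_2<\cdots$, and let $A_N=\{a_1,\dots,a_N\}$ be the set of its smallest $N$ elements. The additive energy of a finite set $A$ of integers is $$E(A)=\#\{(a,b,c,d)\in A^4 : a+b=c+d\}.$$ For $\alpha,\gamma\in\mathbb{T}$, $s>0$, $N\in\mathbb{N}$, define $$F(\alpha,\gamma,s,N,\mathcal{A})=\frac1N\#\Big\{(i,j)\in[N]\times[N] : i\neq j,\ \|a_i\alpha-a_j\alpha-\gamma\|\le \frac sN\Big\}.$$ For functions $f,g:\mathbb{N}\to\mathbb{R}_{\ge0}$, $f\ll g$ means $f=O(g)$. *)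

theory Defs
  imports "HOL-Analysis.Analysis" "HOL-Library.Landau_Symbols"
begin

text \<open>
  Points of the torus \<open>\<real>/\<int>\<close> are given by real representatives. The function
  \<open>circle_norm\<close> and hence \<open>pair_count\<close> below do not depend on the choice of
  representatives (\<open>circle_norm_add_int\<close>, \<open>pair_count_periodic\<close>), and Lebesgue measure
  on the two-dimensional torus is Lebesgue measure on its fundamental domain
  \<open>[0,1) \<times> [0,1)\<close>.
\<close>

definition circle_norm :: "real \<Rightarrow> real" where
  "circle_norm x = infdist x \<int>"

text \<open>The elements are numbered from 1, whereas \<open>enumerate\<close> starts at 0.\<close>

definition nth_elem :: "nat set \<Rightarrow> nat \<Rightarrow> nat" where
  "nth_elem A i = enumerate A (i - 1)"

definition first_elems :: "nat set \<Rightarrow> nat \<Rightarrow> nat set" where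
  "first_elems A N = nth_elem A ` {1..N}"

definition additive_energy :: "'a::ab_semigroup_add set \<Rightarrow> nat" where
  "additive_energy A =
     card {(a, b, c, d). a \<in> A \<and> b \<in> A \<and> c \<in> A \<and> d \<in> A \<and> a + b = c + d}"

definition pair_count :: "real \<Rightarrow> real \<Rightarrow> real \<Rightarrow> nat \<Rightarrow> nat set \<Rightarrow> real" where
  "pair_count \<alpha> \<gamma> s N A =
     1 / real N * real (card {(i, j). i \<in> {1..N} \<and> j \<in> {1..N} \<and> i \<noteq> j \<and>
       circle_norm (real (nth_elem A i) * \<alpha> - real (nth_elem A j) * \<alpha> - \<gamma>) \<le> s / real N})"

definition doubly_metric_poissonian :: "nat set \<Rightarrow> bool" where
  "doubly_metric_poissonian A \<longleftrightarrow>
     (AE (\<alpha>, \<gamma>) in lebesgue_on ({0..<1} \<times> {0..<1}).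
        \<forall>s>0. (\<lambda>N. pair_count \<alpha> \<gamma> s N A) \<longlonglongrightarrow> 2 * s)"

lemma circle_norm_add_int:
  assumes "k \<in> \<int>"
  shows "circle_norm (x + k) = circle_norm x"
proof -
  have "bij_betw (\<lambda>z. z + k) \<int> \<int>"
    using assms by (intro bij_betw_byWitness[where f' = "\<lambda>z. z - k"]) auto
  then have shift: "(\<lambda>z. z + k) ` \<int> = \<int>"
    by (rule bij_betw_imp_surj_on)
  have "dist (x + k) ` \<int> = dist (x + k) ` ((\<lambda>z. z + k) ` \<int>)"
    unfolding shift ..
  also have "\<dots> = dist x ` \<int>"
    unfolding image_image by (simp add: dist_norm)
  finally have "dist (x + k) ` \<int> = dist x ` \<int>" .
  moreover have "(\<int> :: real set) \<noteq> {}"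
    by (metis Ints_0 empty_iff)
  ultimately show ?thesis
    by (simp add: circle_norm_def infdist_notempty)
qed

lemma pair_count_periodic:
  assumes "k \<in> \<int>" "l \<in> \<int>"
  shows "pair_count (\<alpha> + k) (\<gamma> + l) s N A = pair_count \<alpha> \<gamma> s N A"
proof -
  have "circle_norm (real m * (\<alpha> + k) - real n * (\<alpha> + k) - (\<gamma> + l))
        = circle_norm (real m * \<alpha> - real n * \<alpha> - \<gamma>)" for m n
  proof -
    have "real m * k - real n * k - l \<in> \<int>"
      using assms by (intro Ints_diff Ints_mult) auto
    from circle_norm_add_int[OF this, of "real m * \<alpha> - real n * \<alpha> - \<gamma>"]
    show ?thesis by (simp add: algebra_simps)
  qed
  then show ?thesis
    by (simp add: pair_count_def)
qed

end

theory Submission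
  imports Defs
begin

text \<open>
  For distinct integers \<open>d\<close>, \<open>e\<close> the random variables \<open>d\<alpha> - \<gamma>\<close> and \<open>e\<alpha> - \<gamma>\<close> on the torus are independent and
  uniformly distributed. Hence in the variance of \<open>F(\<alpha>, \<gamma>, s, N, A)\<close> only those pairs of index pairs
  contribute that have equal differences, and their number is at most the additive energy: the
  variance is at most \<open>2s E(A\<^sub>N) / N\<^sup>3\<close>, which is \<open>O(\<psi>(N))\<close>. For fixed \<open>c\<close> this is summable along
  \<open>N = 2\<^sup>k c\<close> by Cauchy condensation, so \<open>F \<rightarrow> 2s\<close> almost surely along all these sequences, for all
  rational \<open>s\<close>. Given \<open>m\<close>, every large \<open>N\<close> satisfies \<open>2\<^sup>k c \<le> N < 2\<^sup>k (c + 1)\<close> for some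
  \<open>m \<le> c < 2m\<close>, and monotonicity of the unnormalised counts interpolates between the two ends
  with an error factor of \<open>1 + 1/m\<close>.
\<close>

section \<open>Distance to the nearest integer\<close>

lemma circle_norm_measurable [measurable]: "circle_norm \<in> borel_measurable borel"
proof -
  have "continuous_on UNIV (\<lambda>x::real. infdist x \<int>)"
    by (intro continuous_intros)
  then show ?thesis
    unfolding circle_norm_def[abs_def] by (rule borel_measurable_continuous_onI)
qed

lemma circle_norm_minus: "circle_norm (- x) = circle_norm x"
proof -
  have neg: "uminus ` \<int> = (\<int> :: real set)"
    by (auto simp: image_iff minus_in_Ints_iff intro!: bexI[of _ "- _"])
  have "dist (- x) ` \<int> = dist (- x) ` uminus ` \<int>"
    unfolding neg ..
  also have "\<dots> = dist x ` \<int>"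
    unfolding image_image by (simp add: dist_real_def abs_minus_commute)
  finally have "dist (- x) ` \<int> = dist x ` \<int>" .
  moreover have "(\<int> :: real set) \<noteq> {}"
    by (metis Ints_0 empty_iff)
  ultimately show ?thesis
    by (simp add: circle_norm_def infdist_notempty)
qed

text \<open>On \<open>[0,1)\<close> the nearest integer is 0 or 1, so the norm is
  \<open>min x (1 - x)\<close>.\<close>

lemma circle_norm_le_iff:
  assumes "0 \<le> x" "x < 1"
  shows "circle_norm x \<le> t \<longleftrightarrow> x \<le> t \<or> 1 - t \<le> x"
proof -
  have ne: "(\<int> :: real set) \<noteq> {}"
    by (metis Ints_0 empty_iff)
  have "circle_norm x = min x (1 - x)"
  proof (rule antisym)
    have "infdist x \<int> \<le> dist x 0" "infdist x \<int> \<le> dist x 1"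
      using infdist_le[of 0 "\<int>" x] infdist_le[of 1 "\<int>" x] by simp_all
    with assms show "circle_norm x \<le> min x (1 - x)"
      by (simp add: circle_norm_def dist_norm)
  next
    have "min x (1 - x) \<le> dist x z" if "z \<in> \<int>" for z
    proof -
      from that obtain k where k: "z = real_of_int k"
        by (elim Ints_cases)
      consider "k \<le> 0" | "k \<ge> 1" by linarith
      then have "z \<le> 0 \<or> z \<ge> 1"
        using k by cases auto
      with assms show ?thesis
        by (auto simp: dist_real_def)
    qed
    then show "min x (1 - x) \<le> circle_norm x"
      unfolding circle_norm_def infdist_notempty[OF ne] by (intro cINF_greatest ne)
  qed
  then show ?thesis
    by auto
qed

section \<open>Lebesgue measure on the circle and on the two-dimensional torus\<close>

text \<open>A density keeps the whole real line as space, so translates and dilates of a point stay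
  inside it and measurability remains plain Borel measurability.\<close>

definition unit_measure :: "real measure" where
  "unit_measure = density lborel (indicator {0..<1})"

lemma sets_unit_measure [measurable_cong, simp]: "sets unit_measure = sets borel"
  by (simp add: unit_measure_def)

lemma space_unit_measure [simp]: "space unit_measure = UNIV"
  by (simp add: unit_measure_def)

lemma nn_integral_unit_measure:
  "f \<in> borel_measurable borel \<Longrightarrow>
     (\<integral>\<^sup>+x. f x \<partial>unit_measure) = (\<integral>\<^sup>+x. f x * indicator {0..<1} x \<partial>lborel)"
  by (simp add: unit_measure_def nn_integral_density mult.commute)

lemma emeasure_unit_measure_UNIV: "emeasure unit_measure UNIV = 1"
  by (simp add: unit_measure_def emeasure_density)

interpretation unit: finite_measure unit_measure
  by standard (simp add: emeasure_unit_measure_UNIV)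

interpretation torus: pair_sigma_finite unit_measure unit_measure ..

abbreviation "torus \<equiv> unit_measure \<Otimes>\<^sub>M unit_measure"

lemma emeasure_torus_space: "emeasure torus (space torus) = 1"
proof -
  have "emeasure torus (UNIV \<times> UNIV) = 1"
    by (subst unit.emeasure_pair_measure_Times) (auto simp: emeasure_unit_measure_UNIV)
  then show ?thesis by (simp add: space_pair_measure)
qed

interpretation torus_fin: finite_measure torus
  by standard (simp add: emeasure_torus_space)

section \<open>Integrals of 1-periodic functions under translation and dilation\<close>

lemma periodic_of_int:
  fixes f :: "real \<Rightarrow> 'a"
  assumes "\<And>x. f (x + 1) = f x"
  shows "f (x + of_int k) = f x"
proof -
  have nat: "f (y + real n) = f y" for y n
  proof (induction n)
    case (Suc n)
    then show ?case
      using assms[of "y + real n"] by (simp add: add_ac)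
  qed simp
  show ?thesis
  proof (cases "k \<ge> 0")
    case True
    then show ?thesis using nat[of x "nat k"] by simp
  next
    case False
    then show ?thesis using nat[of "x + of_int k" "nat (- k)"] by simp
  qed
qed

lemma nn_integral_translate:
  fixes f :: "real \<Rightarrow> ennreal"
  assumes "f \<in> borel_measurable borel"
  shows "(\<integral>\<^sup>+x. f (x + c) \<partial>lborel) = (\<integral>\<^sup>+x. f x \<partial>lborel)"
  using nn_integral_real_affine[OF assms, of 1 c] by (simp add: add.commute)

text \<open>Substituting \<open>x + of_int k\<close> moves the interval back, and periodicity
  removes the shift from \<open>f\<close>.\<close>

lemma nn_integral_periodic_interval:
  fixes f :: "real \<Rightarrow> ennreal"
  assumes [measurable]: "f \<in> borel_measurable borel" and per: "\<And>x. f (x + 1) = f x"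
  shows "(\<integral>\<^sup>+x. f x * indicator {a + of_int k..<b + of_int k} x \<partial>lborel)
       = (\<integral>\<^sup>+x. f x * indicator {a..<b} x \<partial>lborel)"
proof -
  have "(\<integral>\<^sup>+x. f x * indicator {a + of_int k..<b + of_int k} x \<partial>lborel)
      = (\<integral>\<^sup>+x. f (x + of_int k) * indicator {a + of_int k..<b + of_int k} (x + of_int k) \<partial>lborel)"
    by (rule nn_integral_translate[symmetric]) measurable
  also have "\<dots> = (\<integral>\<^sup>+x. f x * indicator {a..<b} x \<partial>lborel)"
    unfolding periodic_of_int[of f, OF per]
    by (intro nn_integral_cong) (auto simp: indicator_def)
  finally show ?thesis .
qed

text \<open>Only the fractional part \<open>r\<close> of \<open>c\<close> matters. It moves the
  window \<open>[0,1)\<close> to \<open>[r,r+1)\<close>, whose part beyond 1 is moved back to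
  \<open>[0,r)\<close> by periodicity.\<close>

lemma nn_integral_periodic_translate:
  fixes f :: "real \<Rightarrow> ennreal"
  assumes f [measurable]: "f \<in> borel_measurable borel" and per: "\<And>x. f (x + 1) = f x"
  shows "(\<integral>\<^sup>+x. f (x + c) \<partial>unit_measure) = (\<integral>\<^sup>+x. f x \<partial>unit_measure)"
proof -
  define r where "r = frac c"
  have r: "0 \<le> r" "r < 1"
    by (auto simp: r_def frac_lt_1)
  have "f (x + c) = f (x + r)" for x
    using periodic_of_int[of f "x + r" "\<lfloor>c\<rfloor>", OF per] by (simp add: r_def frac_def add_ac)
  then have "(\<integral>\<^sup>+x. f (x + c) \<partial>unit_measure) = (\<integral>\<^sup>+x. f (x + r) * indicator {0..<1} x \<partial>lborel)"
    by (simp add: nn_integral_unit_measure)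
  also have "\<dots> = (\<integral>\<^sup>+x. f (x + r) * indicator {r..<r + 1} (x + r) \<partial>lborel)"
    by (intro nn_integral_cong) (auto simp: indicator_def)
  also have "\<dots> = (\<integral>\<^sup>+x. f x * indicator {r..<r + 1} x \<partial>lborel)"
    by (rule nn_integral_translate) measurable
  \<comment> \<open>The end points \<open>0 + of_int 1\<close> and \<open>r + of_int 1\<close> are
    left unsimplified so that \<open>nn_integral_periodic_interval\<close> applies as a rewrite
    rule.\<close>
  also have "\<dots> = (\<integral>\<^sup>+x. f x * indicator {r..<1} x + f x * indicator {0 + of_int 1..<r + of_int 1} x \<partial>lborel)"
    using r by (intro nn_integral_cong) (auto simp: indicator_def)
  also have "\<dots> = (\<integral>\<^sup>+x. f x * indicator {r..<1} x \<partial>lborel) + (\<integral>\<^sup>+x. f x * indicator {0..<r} x \<partial>lborel)"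
    by (subst nn_integral_add) (simp_all only: nn_integral_periodic_interval[OF f per], measurable)
  also have "\<dots> = (\<integral>\<^sup>+x. f x * indicator {r..<1} x + f x * indicator {0..<r} x \<partial>lborel)"
    by (subst nn_integral_add) auto
  also have "\<dots> = (\<integral>\<^sup>+x. f x * indicator {0..<1} x \<partial>lborel)"
    using r by (intro nn_integral_cong) (auto simp: indicator_def)
  finally show ?thesis
    by (simp add: nn_integral_unit_measure)
qed

text \<open>The substitution \<open>n * x\<close> stretches the unit interval to
  \<open>[0,n)\<close>, which consists of \<open>n\<close> full periods; the Jacobian cancels this
  factor.\<close>

lemma nn_integral_periodic_dilate:
  fixes f :: "real \<Rightarrow> ennreal"
  assumes f [measurable]: "f \<in> borel_measurable borel" and per: "\<And>x. f (x + 1) = f x" and n: "n > 0"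
  shows "(\<integral>\<^sup>+x. f (real n * x) \<partial>unit_measure) = (\<integral>\<^sup>+x. f x \<partial>unit_measure)"
proof -
  let ?I = "\<integral>\<^sup>+x. f x * indicator {0..<1} x \<partial>lborel"
  have split: "(\<integral>\<^sup>+x. f x * indicator {0..<real m} x \<partial>lborel) = of_nat m * ?I" for m
  proof (induction m)
    case (Suc m)
    have "(\<integral>\<^sup>+x. f x * indicator {0..<real (Suc m)} x \<partial>lborel)
        = (\<integral>\<^sup>+x. f x * indicator {0..<real m} x
              + f x * indicator {0 + of_int (int m)..<1 + of_int (int m)} x \<partial>lborel)"
      by (intro nn_integral_cong) (auto simp: indicator_def)
    also have "\<dots> = of_nat m * ?I + ?I"
      by (subst nn_integral_add) (simp_all only: nn_integral_periodic_interval[OF f per] Suc.IH, measurable)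
    finally show ?case
      by (simp add: algebra_simps)
  qed simp
  \<comment> \<open>Both sides are multiplied by \<open>n\<close> to avoid division in
    \<open>ennreal\<close>; the factor is cancelled at the end, being finite and nonzero.\<close>
  have "of_nat n * (\<integral>\<^sup>+x. f (real n * x) \<partial>unit_measure)
      = of_nat n * (\<integral>\<^sup>+x. f (0 + real n * x) * indicator {0..<real n} (0 + real n * x) \<partial>lborel)"
    using n by (subst nn_integral_unit_measure)
      (auto simp: indicator_def zero_le_mult_iff intro!: arg_cong2[where f="(*)"] nn_integral_cong)
  also have "\<dots> = (\<integral>\<^sup>+x. f x * indicator {0..<real n} x \<partial>lborel)"
    using nn_integral_real_affine[of "\<lambda>x. f x * indicator {0..<real n} x" "real n" 0] n
    by (simp add: ennreal_of_nat_eq_real_of_nat)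
  also have "\<dots> = of_nat n * (\<integral>\<^sup>+x. f x \<partial>unit_measure)"
    by (simp add: split nn_integral_unit_measure)
  finally show ?thesis
    using n by (simp add: ennreal_mult_cancel_left ennreal_of_nat_eq_real_of_nat)
qed

section \<open>Uniform distribution and pairwise independence on the torus\<close>

lemma nn_integral_torus_single:
  fixes f :: "real \<Rightarrow> ennreal"
  assumes f [measurable]: "f \<in> borel_measurable borel" and per: "\<And>x. f (x + 1) = f x"
    and even: "\<And>x. f (- x) = f x"
  shows "(\<integral>\<^sup>+(x, y). f (of_int d * x - y) \<partial>torus) = (\<integral>\<^sup>+x. f x \<partial>unit_measure)"
proof -
  have "(\<integral>\<^sup>+(x, y). f (of_int d * x - y) \<partial>torus)
      = (\<integral>\<^sup>+x. \<integral>\<^sup>+y. f (of_int d * x - y) \<partial>unit_measure \<partial>unit_measure)"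
    by (subst unit.nn_integral_fst[symmetric]) auto
  also have "\<dots> = (\<integral>\<^sup>+x. \<integral>\<^sup>+y. f y \<partial>unit_measure \<partial>unit_measure)"
  proof (rule nn_integral_cong)
    \<comment> \<open>Evenness turns the reflected translate \<open>of_int d * x - y\<close> into a
      translate of \<open>y\<close>, so the inner integral does not depend on
      \<open>x\<close>.\<close>
    fix x :: real
    show "(\<integral>\<^sup>+y. f (of_int d * x - y) \<partial>unit_measure) = (\<integral>\<^sup>+y. f y \<partial>unit_measure)"
      using nn_integral_periodic_translate[OF f per, of "- (of_int d * x)"]
      by (subst even[symmetric]) simp
  qed
  finally show ?thesis
    by (simp add: emeasure_unit_measure_UNIV)
qed

text \<open>After a change of variable in \<open>y\<close> the product is
  \<open>f (n * x - y) * f y\<close> with \<open>n = d - e\<close>. For fixed \<open>y\<close>,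
  integration over \<open>x\<close> sees only a dilation and a translation, both measure preserving,
  and the integral factors.\<close>

lemma nn_integral_torus_pair_less:
  fixes f :: "real \<Rightarrow> ennreal"
  assumes f [measurable]: "f \<in> borel_measurable borel" and per: "\<And>x. f (x + 1) = f x"
    and even: "\<And>x. f (- x) = f x" and less: "e < d"
  shows "(\<integral>\<^sup>+(x, y). f (of_int d * x - y) * f (of_int e * x - y) \<partial>torus)
       = (\<integral>\<^sup>+x. f x \<partial>unit_measure) * (\<integral>\<^sup>+x. f x \<partial>unit_measure)"
proof -
  define n where "n = nat (d - e)"
  have n: "n > 0" "of_int d = real n + real_of_int e"
    using less by (auto simp: n_def)
  have "(\<integral>\<^sup>+(x, y). f (of_int d * x - y) * f (of_int e * x - y) \<partial>torus)
      = (\<integral>\<^sup>+x. \<integral>\<^sup>+y. f (of_int d * x - y) * f (of_int e * x - y) \<partial>unit_measure \<partial>unit_measure)"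
    by (subst unit.nn_integral_fst[symmetric]) auto
  also have "\<dots> = (\<integral>\<^sup>+x. \<integral>\<^sup>+y. f (real n * x - y) * f y \<partial>unit_measure \<partial>unit_measure)"
  proof (rule nn_integral_cong)
    fix x :: real
    let ?g = "\<lambda>y. f (real n * x - y) * f y"
    have g: "?g \<in> borel_measurable borel"
      by measurable
    have gper: "?g (y + 1) = ?g y" for y
      using per[of "real n * x - y - 1"] per[of y] by (simp add: algebra_simps)
    \<comment> \<open>Translate \<open>y\<close> by \<open>e x\<close>; afterwards only the positive difference \<open>n = d - e\<close> multiplies \<open>x\<close>.\<close>
    have "(\<integral>\<^sup>+y. f (of_int d * x - y) * f (of_int e * x - y) \<partial>unit_measure)
        = (\<integral>\<^sup>+y. ?g (y + (- of_int e * x)) \<partial>unit_measure)"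
      using even[of "_ - _"] by (intro nn_integral_cong) (simp add: n(2) algebra_simps)
    also have "\<dots> = (\<integral>\<^sup>+y. ?g y \<partial>unit_measure)"
      by (rule nn_integral_periodic_translate[OF g gper])
    finally show "(\<integral>\<^sup>+y. f (of_int d * x - y) * f (of_int e * x - y) \<partial>unit_measure)
        = (\<integral>\<^sup>+y. ?g y \<partial>unit_measure)" .
  qed
  \<comment> \<open>The order is exchanged because \<open>x\<close> now occurs in only one of the
    two factors.\<close>
  also have "\<dots> = (\<integral>\<^sup>+y. \<integral>\<^sup>+x. f (real n * x - y) * f y \<partial>unit_measure \<partial>unit_measure)"
    by (rule torus.Fubini') measurable
  also have "\<dots> = (\<integral>\<^sup>+y. (\<integral>\<^sup>+x. f x \<partial>unit_measure) * f y \<partial>unit_measure)"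
  proof (rule nn_integral_cong)
    fix y :: real
    have "(\<integral>\<^sup>+x. f (real n * x - y) \<partial>unit_measure) = (\<integral>\<^sup>+x. f (x - y) \<partial>unit_measure)"
      using per by (intro nn_integral_periodic_dilate[OF _ _ n(1)])
        (measurable, simp add: diff_add_eq[symmetric])
    also have "\<dots> = (\<integral>\<^sup>+x. f x \<partial>unit_measure)"
      using nn_integral_periodic_translate[OF f per, of "- y"] by simp
    finally show "(\<integral>\<^sup>+x. f (real n * x - y) * f y \<partial>unit_measure) = (\<integral>\<^sup>+x. f x \<partial>unit_measure) * f y"
      by (subst nn_integral_multc) auto
  qed
  also have "\<dots> = (\<integral>\<^sup>+x. f x \<partial>unit_measure) * (\<integral>\<^sup>+x. f x \<partial>unit_measure)"
    by (rule nn_integral_cmult) auto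
  finally show ?thesis .
qed

text \<open>Dilation requires a positive factor; the other order of \<open>d\<close> and
  \<open>e\<close> follows by swapping the two factors.\<close>

lemma nn_integral_torus_pair:
  fixes f :: "real \<Rightarrow> ennreal"
  assumes "f \<in> borel_measurable borel" "\<And>x. f (x + 1) = f x" "\<And>x. f (- x) = f x" "d \<noteq> e"
  shows "(\<integral>\<^sup>+(x, y). f (of_int d * x - y) * f (of_int e * x - y) \<partial>torus)
       = (\<integral>\<^sup>+x. f x \<partial>unit_measure) * (\<integral>\<^sup>+x. f x \<partial>unit_measure)"
proof (cases "e < d")
  case True
  then show ?thesis by (rule nn_integral_torus_pair_less[OF assms(1-3)])
next
  case False
  with assms(4) have "d < e" by simp
  then show ?thesis
    using nn_integral_torus_pair_less[OF assms(1-3)] by (simp add: mult.commute)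
qed

section \<open>Probabilities and covariances of the events \<open>near t d\<close>\<close>

lemma nn_integral_unit_measure_near:
  assumes "0 \<le> t" "t < 1 / 2"
  shows "(\<integral>\<^sup>+z. indicator {z. circle_norm z \<le> t} z \<partial>unit_measure) = ennreal (2 * t)"
proof -
  \<comment> \<open>The arcs at the two ends of the unit interval are disjoint because
    \<open>t < 1 / 2\<close>.\<close>
  have "(\<integral>\<^sup>+z. indicator {z. circle_norm z \<le> t} z \<partial>unit_measure)
      = (\<integral>\<^sup>+z. indicator {0..t} z + indicator {1 - t..<1} z \<partial>lborel)"
    using assms by (subst nn_integral_unit_measure)
      (auto simp: indicator_def circle_norm_le_iff intro!: nn_integral_cong)
  also have "\<dots> = ennreal t + ennreal t"
    using assms by (subst nn_integral_add) auto
  finally show ?thesis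
    using assms by (simp add: ennreal_plus[symmetric] del: ennreal_plus)
qed

text \<open>The integer \<open>d\<close> stands for a difference of two elements of
  \<open>A\<close>, of either sign.\<close>

definition near :: "real \<Rightarrow> int \<Rightarrow> (real \<times> real) set" where
  "near t d = {(x, y). circle_norm (of_int d * x - y) \<le> t}"

lemma near_sets [measurable]: "near t d \<in> sets torus"
proof -
  have "{p \<in> space torus. circle_norm (of_int d * fst p - snd p) \<le> t} \<in> sets torus"
    by measurable
  then show ?thesis
    by (simp add: near_def space_pair_measure case_prod_unfold)
qed

lemma circle_norm_add_1: "circle_norm (x + 1) = circle_norm x"
  by (rule circle_norm_add_int) simp

text \<open>Bundles the measurability, periodicity and evenness that the torus integrals require of
  \<open>f\<close>.\<close>

lemma near_0_indicator:
  fixes t :: real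
  defines "f \<equiv> indicator {z. circle_norm z \<le> t} :: real \<Rightarrow> ennreal"
  shows "f \<in> borel_measurable borel" "f (x + 1) = f x" "f (- x) = f x"
proof -
  show "f \<in> borel_measurable borel"
    unfolding f_def by measurable
qed (simp_all add: f_def indicator_def circle_norm_add_1 circle_norm_minus)

text \<open>The probability does not depend on \<open>d\<close>, and \<open>d = 0\<close> is
  included, since the second coordinate alone is already uniformly distributed.\<close>

lemma measure_near:
  assumes "0 \<le> t" "t < 1 / 2"
  shows "measure torus (near t d) = 2 * t"
proof -
  let ?f = "indicator {z. circle_norm z \<le> t} :: real \<Rightarrow> ennreal"
  have "emeasure torus (near t d) = (\<integral>\<^sup>+p. indicator (near t d) p \<partial>torus)"
    by (rule nn_integral_indicator[symmetric]) measurable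
  also have "\<dots> = (\<integral>\<^sup>+(x, y). ?f (of_int d * x - y) \<partial>torus)"
    by (intro nn_integral_cong) (auto simp: near_def indicator_def)
  also have "\<dots> = (\<integral>\<^sup>+x. ?f x \<partial>unit_measure)"
    by (rule nn_integral_torus_single[of ?f, OF near_0_indicator])
  also have "\<dots> = ennreal (2 * t)"
    by (rule nn_integral_unit_measure_near[OF assms])
  finally show ?thesis
    using assms by (simp add: measure_def)
qed

lemma measure_near_Int:
  assumes "0 \<le> t" "t < 1 / 2" "d \<noteq> e"
  shows "measure torus (near t d \<inter> near t e) = (2 * t)\<^sup>2"
proof -
  let ?f = "indicator {z. circle_norm z \<le> t} :: real \<Rightarrow> ennreal"
  have "emeasure torus (near t d \<inter> near t e) = (\<integral>\<^sup>+p. indicator (near t d \<inter> near t e) p \<partial>torus)"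
    by (rule nn_integral_indicator[symmetric]) measurable
  also have "\<dots> = (\<integral>\<^sup>+(x, y). ?f (of_int d * x - y) * ?f (of_int e * x - y) \<partial>torus)"
    by (intro nn_integral_cong) (auto simp: near_def indicator_def)
  also have "\<dots> = (\<integral>\<^sup>+x. ?f x \<partial>unit_measure) * (\<integral>\<^sup>+x. ?f x \<partial>unit_measure)"
    by (rule nn_integral_torus_pair[of ?f, OF near_0_indicator assms(3)])
  also have "\<dots> = ennreal ((2 * t)\<^sup>2)"
    unfolding nn_integral_unit_measure_near[OF assms(1,2)] power2_eq_square
    using assms by (intro ennreal_mult[symmetric]) auto
  finally show ?thesis
    by (simp add: measure_def)
qed

lemma integrable_torus_indicator: "S \<in> sets torus \<Longrightarrow> integrable torus (indicator S :: _ \<Rightarrow> real)"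
  by (simp add: less_top[symmetric])

text \<open>Distinct \<open>d\<close> and \<open>e\<close> give independent, hence uncorrelated
  events; for \<open>d = e\<close> this is the variance of an indicator of probability
  \<open>2 * t\<close>.\<close>

lemma integral_near_covariance:
  assumes "0 \<le> t" "t < 1 / 2"
  shows "(\<integral>p. (indicator (near t d) p - 2 * t) * (indicator (near t e) p - 2 * t) \<partial>torus)
       = (if d = e then 2 * t - (2 * t)\<^sup>2 else 0 :: real)"
proof -
  have [simp]: "measure torus UNIV = 1"
    using emeasure_torus_space by (simp add: measure_def space_pair_measure)
  have [simp]: "integrable torus (indicator (near t d \<inter> near t e) :: _ \<Rightarrow> real)"
    "integrable torus (indicator (near t d) :: _ \<Rightarrow> real)"
    "integrable torus (indicator (near t e) :: _ \<Rightarrow> real)"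
    by (intro integrable_torus_indicator sets.Int near_sets)+
  have "(\<integral>p. (indicator (near t d) p - 2 * t) * (indicator (near t e) p - 2 * t) \<partial>torus)
      = (\<integral>p. indicator (near t d \<inter> near t e) p - 2 * t * indicator (near t d) p
             - 2 * t * indicator (near t e) p + (2 * t)\<^sup>2 \<partial>torus)"
    by (intro Bochner_Integration.integral_cong)
      (auto simp: indicator_inter_arith algebra_simps power2_eq_square)
  also have "\<dots> = measure torus (near t d \<inter> near t e) - 2 * t * measure torus (near t d)
      - 2 * t * measure torus (near t e) + (2 * t)\<^sup>2"
    by (simp add: space_pair_measure)
  also have "\<dots> = (if d = e then 2 * t - (2 * t)\<^sup>2 else 0)"
    using assms by (simp add: measure_near measure_near_Int power2_eq_square algebra_simps)
  finally show ?thesis .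
qed

text \<open>Expanding the square gives a double sum of covariances, in which only pairs with equal
  \<open>d\<close>-values survive. The map \<open>d\<close> may repeat values on \<open>Q\<close>,
  and the right-hand side counts these coincidences.\<close>

lemma second_moment_near:
  assumes t: "0 \<le> t" "t < 1 / 2" and Q: "finite Q"
  shows "(\<integral>p. ((\<Sum>q\<in>Q. indicator (near t (d q)) p) - 2 * t * real (card Q))\<^sup>2 \<partial>torus)
       \<le> 2 * t * real (card {(q, r). q \<in> Q \<and> r \<in> Q \<and> d q = d r})"
proof -
  let ?c = "\<lambda>q p. indicator (near t (d q)) p - 2 * t"
  have int: "integrable torus (\<lambda>p. ?c q p * ?c r p)" for q r
  proof (rule torus_fin.integrable_const_bound[where B = "(1 + 2 * t) * (1 + 2 * t)"])
    have "\<bar>?c q p\<bar> \<le> 1 + 2 * t" for q p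
      using t by (auto simp: indicator_def)
    then show "AE p in torus. norm (?c q p * ?c r p) \<le> (1 + 2 * t) * (1 + 2 * t)"
      using t by (auto simp: abs_mult intro!: mult_mono)
  qed measurable
  have "((\<Sum>q\<in>Q. indicator (near t (d q)) p) - 2 * t * real (card Q))\<^sup>2
      = (\<Sum>q\<in>Q. \<Sum>r\<in>Q. ?c q p * ?c r p)" for p
    by (simp add: sum_product[symmetric] sum_subtractf power2_eq_square mult.commute)
  then have "(\<integral>p. ((\<Sum>q\<in>Q. indicator (near t (d q)) p) - 2 * t * real (card Q))\<^sup>2 \<partial>torus)
      = (\<Sum>q\<in>Q. \<Sum>r\<in>Q. \<integral>p. ?c q p * ?c r p \<partial>torus)"
    using int by (simp add: Bochner_Integration.integral_sum integrable_sum)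
  \<comment> \<open>The negative term of the variance is dropped.\<close>
  also have "\<dots> \<le> (\<Sum>q\<in>Q. \<Sum>r\<in>Q. if d q = d r then 2 * t else 0)"
    unfolding integral_near_covariance[OF t] by (intro sum_mono) auto
  also have "\<dots> = (\<Sum>(q, r)\<in>Q \<times> Q. if d q = d r then 2 * t else 0)"
    by (rule sum.cartesian_product)
  also have "\<dots> = (\<Sum>(q, r)\<in>{(q, r). q \<in> Q \<and> r \<in> Q \<and> d q = d r}. 2 * t)"
    using Q by (intro sum.mono_neutral_cong_right) (auto split: if_splits)
  finally show ?thesis
    by (simp add: case_prod_unfold mult.commute)
qed

section \<open>Pair counts, differences and additive energy\<close>

definition off_diagonal :: "nat \<Rightarrow> (nat \<times> nat) set" where
  "off_diagonal N = {(i, j). i \<in> {1..N} \<and> j \<in> {1..N} \<and> i \<noteq> j}"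

lemma finite_off_diagonal [simp]: "finite (off_diagonal N)"
  by (rule finite_subset[of _ "{1..N} \<times> {1..N}"]) (auto simp: off_diagonal_def)

lemma card_off_diagonal: "real (card (off_diagonal N)) = real N * (real N - 1)"
proof -
  have eq: "off_diagonal N = {1..N} \<times> {1..N} - (\<lambda>i. (i, i)) ` {1..N}"
    by (auto simp: off_diagonal_def)
  moreover have "card ((\<lambda>i. (i, i)) ` {1..N}) = N"
    by (subst card_image) (auto simp: inj_on_def)
  ultimately have "card (off_diagonal N) = N * N - N"
    unfolding eq by (subst card_Diff_subset) auto
  then show ?thesis
    by (cases N) (auto simp: algebra_simps)
qed

text \<open>Taken in \<open>int\<close>, since subtraction of naturals would truncate.\<close>

definition elem_diff :: "nat set \<Rightarrow> nat \<times> nat \<Rightarrow> int" where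
  "elem_diff A = (\<lambda>(i, j). int (nth_elem A i) - int (nth_elem A j))"

text \<open>Writes the count as a sum of indicator variables on the torus, to which
  \<open>second_moment_near\<close> applies.\<close>

lemma pair_count_eq_sum_near:
  "pair_count x y s N A
     = (\<Sum>q\<in>off_diagonal N. indicator (near (s / real N) (elem_diff A q)) (x, y)) / real N"
proof -
  have "(\<Sum>q\<in>off_diagonal N. indicator (near (s / real N) (elem_diff A q)) (x, y))
      = real (card {q \<in> off_diagonal N. (x, y) \<in> near (s / real N) (elem_diff A q)})"
    by (simp add: indicator_def sum.If_cases Int_def)
  also have "{q \<in> off_diagonal N. (x, y) \<in> near (s / real N) (elem_diff A q)}
      = {(i, j). i \<in> {1..N} \<and> j \<in> {1..N} \<and> i \<noteq> j \<and>
         circle_norm (real (nth_elem A i) * x - real (nth_elem A j) * x - y) \<le> s / real N}"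
    by (auto simp: off_diagonal_def near_def elem_diff_def algebra_simps)
  finally show ?thesis
    by (simp add: pair_count_def)
qed

text \<open>Injectivity starts at 1, because \<open>nth_elem A 0\<close> and
  \<open>nth_elem A 1\<close> coincide by truncated subtraction.\<close>

lemma inj_on_nth_elem:
  assumes "infinite A"
  shows "inj_on (nth_elem A) {1..}"
proof (rule inj_onI)
  fix i j :: nat
  assume ij: "i \<in> {1..}" "j \<in> {1..}" "nth_elem A i = nth_elem A j"
  have "i - 1 = j - 1"
    using inj_enumerate[OF assms] ij(3) unfolding nth_elem_def by (rule injD)
  with ij show "i = j"
    by simp
qed

lemma card_equal_differences_le_energy:
  assumes "infinite A"
  shows "card {(q, r). q \<in> off_diagonal N \<and> r \<in> off_diagonal N \<and> elem_diff A q = elem_diff A r}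
       \<le> additive_energy (first_elems A N)"
  unfolding additive_energy_def
proof (rule card_inj_on_le)
  let ?a = "nth_elem A"
  \<comment> \<open>The equation \<open>a i - a j = a k - a l\<close> is rearranged to
    \<open>a i + a l = a k + a j\<close>, which makes sense in the naturals.\<close>
  let ?g = "\<lambda>((i, j), (k, l)). (?a i, ?a l, ?a k, ?a j)"
  show "inj_on ?g {(q, r). q \<in> off_diagonal N \<and> r \<in> off_diagonal N \<and> elem_diff A q = elem_diff A r}"
    by (rule inj_onI) (auto simp: off_diagonal_def inj_on_eq_iff[OF inj_on_nth_elem[OF assms]])
  show "?g ` {(q, r). q \<in> off_diagonal N \<and> r \<in> off_diagonal N \<and> elem_diff A q = elem_diff A r}
      \<subseteq> {(a, b, c, d). a \<in> first_elems A N \<and> b \<in> first_elems A N \<and> c \<in> first_elems A N \<and>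
           d \<in> first_elems A N \<and> a + b = c + d}"
    by (auto simp: off_diagonal_def elem_diff_def first_elems_def)
  let ?B = "first_elems A N"
  have "finite ?B"
    by (simp add: first_elems_def)
  then have "finite (?B \<times> ?B \<times> ?B \<times> ?B)"
    by simp
  then show "finite {(a, b, c, d). a \<in> first_elems A N \<and> b \<in> first_elems A N \<and> c \<in> first_elems A N \<and>
           d \<in> first_elems A N \<and> a + b = c + d}"
    by (rule rev_finite_subset) auto
qed

section \<open>Variance of the pair count\<close>

lemma measurable_pair_count [measurable]:
  "(\<lambda>(x, y). pair_count x y s N A) \<in> borel_measurable torus"
  unfolding pair_count_eq_sum_near case_prod_eta by measurable

text \<open>The subtracted constant is the exact mean: \<open>N * (N - 1)\<close> events of
  probability \<open>2 * s / N\<close>, divided by \<open>N\<close>. The hypothesis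
  \<open>N > 2 * s\<close> makes the radius \<open>s / N\<close> smaller than
  \<open>1 / 2\<close>.\<close>

lemma second_moment_pair_count:
  assumes A: "infinite A" and s: "s > 0" and N: "real N > 2 * s"
  shows "(\<integral>\<^sup>+(x, y). ennreal ((pair_count x y s N A - 2 * s * (1 - 1 / real N))\<^sup>2) \<partial>torus)
       \<le> ennreal (2 * s * (real (additive_energy (first_elems A N)) / real N ^ 3))"
proof -
  let ?t = "s / real N"
  let ?Q = "off_diagonal N"
  let ?X = "\<lambda>p. (\<Sum>q\<in>?Q. indicator (near ?t (elem_diff A q)) p) - 2 * ?t * real (card ?Q)"
  have N0: "real N > 0" using s N by linarith
  have t: "0 \<le> ?t" "?t < 1 / 2"
    using s N N0 by (auto simp: field_simps)
  have int: "integrable torus (\<lambda>p. (?X p)\<^sup>2)"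
  proof (rule torus_fin.integrable_const_bound)
    have "\<bar>?X p\<bar> \<le> real (card ?Q) + 2 * ?t * real (card ?Q)" for p
    proof -
      have "(\<Sum>q\<in>?Q. indicator (near ?t (elem_diff A q)) p) \<le> (\<Sum>q\<in>?Q. 1 :: real)"
        by (intro sum_mono) (auto simp: indicator_def)
      moreover have "(\<Sum>q\<in>?Q. indicator (near ?t (elem_diff A q)) p) \<ge> (0 :: real)"
        by (intro sum_nonneg) auto
      moreover have "2 * ?t * real (card ?Q) \<ge> 0"
        using t(1) by (intro mult_nonneg_nonneg) auto
      ultimately show ?thesis unfolding abs_le_iff by simp
    qed
    then have "(?X p)\<^sup>2 \<le> (real (card ?Q) + 2 * ?t * real (card ?Q))\<^sup>2" for p
      by (meson abs_le_square_iff abs_ge_self order_trans)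
    then show "AE p in torus. norm ((?X p)\<^sup>2) \<le> (real (card ?Q) + 2 * ?t * real (card ?Q))\<^sup>2"
      by simp
  qed measurable
  have "pair_count x y s N A - 2 * s * (1 - 1 / real N) = ?X (x, y) / real N" for x y
    unfolding pair_count_eq_sum_near card_off_diagonal using N0 by (simp add: field_simps)
  then have "(\<integral>\<^sup>+(x, y). ennreal ((pair_count x y s N A - 2 * s * (1 - 1 / real N))\<^sup>2) \<partial>torus)
      = (\<integral>\<^sup>+p. ennreal ((?X p)\<^sup>2 / (real N)\<^sup>2) \<partial>torus)"
    by (intro nn_integral_cong) (auto simp: power_divide)
  also have "\<dots> = ennreal ((\<integral>p. (?X p)\<^sup>2 \<partial>torus) / (real N)\<^sup>2)"
    using int by (subst nn_integral_eq_integral) auto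
  also have "\<dots> \<le> ennreal (2 * ?t * real (additive_energy (first_elems A N)) / (real N)\<^sup>2)"
  proof (intro ennreal_leI divide_right_mono)
    have "(\<integral>p. (?X p)\<^sup>2 \<partial>torus)
        \<le> 2 * ?t * real (card {(q, r). q \<in> ?Q \<and> r \<in> ?Q \<and> elem_diff A q = elem_diff A r})"
      by (rule second_moment_near[OF t]) simp
    also have "\<dots> \<le> 2 * ?t * real (additive_energy (first_elems A N))"
      using t card_equal_differences_le_energy[OF A] by (intro mult_left_mono) auto
    finally show "(\<integral>p. (?X p)\<^sup>2 \<partial>torus) \<le> 2 * ?t * real (additive_energy (first_elems A N))" .
  qed simp
  finally show ?thesis
    by (simp add: power2_eq_square power3_eq_cube mult.assoc)
qed

section \<open>Tools for almost everywhere statements\<close>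

lemma AE_torus_imp_AE_lebesgue_on:
  assumes "AE p in torus. P p"
  shows "AE p in lebesgue_on ({0..<1} \<times> {0..<1}). P p"
proof -
  have ind: "(\<lambda>(x, y). indicator {0..<1::real} x * indicator {0..<1::real} y :: ennreal)
      = indicator ({0..<1} \<times> {0..<1})"
    by (auto simp: indicator_def fun_eq_iff)
  have S: "{0..<1::real} \<times> {0..<1::real} \<in> sets lborel"
    unfolding lborel_prod[symmetric] by (intro pair_measureI) auto
  have sf: "sigma_finite_measure (density lborel (indicator {0..<1::real} :: real \<Rightarrow> ennreal))"
    using unit.sigma_finite_measure_axioms by (simp add: unit_measure_def)
  \<comment> \<open>A product of densities is a density of the product, so \<open>torus\<close> is
    planar Lebesgue measure cut down to the unit square.\<close>
  have "torus = density (lborel \<Otimes>\<^sub>M lborel) (indicator ({0..<1} \<times> {0..<1}))"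
    unfolding unit_measure_def
    by (subst pair_measure_density) (simp_all add: ind sf lborel.sigma_finite_measure_axioms)
  then have "torus = density lborel (indicator ({0..<1} \<times> {0..<1}))"
    unfolding lborel_prod .
  then have "AE p in density lborel (indicator ({0..<1} \<times> {0..<1})). P p"
    using assms by (rule subst[where P = "\<lambda>M. AE p in M. P p"])
  then have "AE p in lborel. p \<in> {0..<1} \<times> {0..<1} \<longrightarrow> P p"
    using S by (subst (asm) AE_density) (auto elim!: eventually_mono simp: indicator_def)
  then have "AE p in lebesgue. p \<in> {0..<1} \<times> {0..<1} \<longrightarrow> P p"
    by (rule AE_completion)
  then show ?thesis
    using S by (subst AE_restrict_space_iff) (auto intro: sets_completionI_sets)
qed

text \<open>Integrating the series termwise shows that it is finite almost everywhere, so its terms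
  tend to 0. The bounds hold only eventually, hence the shift by \<open>K\<close>.\<close>

lemma AE_tendsto_0_if_summable_nn_integral:
  fixes f :: "nat \<Rightarrow> 'a \<Rightarrow> real"
  assumes [measurable]: "\<And>k. f k \<in> borel_measurable M" and nonneg: "\<And>k x. f k x \<ge> 0"
    and le: "eventually (\<lambda>k. (\<integral>\<^sup>+x. ennreal (f k x) \<partial>M) \<le> ennreal (b k)) sequentially"
    and b: "summable b" "\<And>k. b k \<ge> 0"
  shows "AE x in M. (\<lambda>k. f k x) \<longlonglongrightarrow> 0"
proof -
  from le obtain K where K: "\<And>k. k \<ge> K \<Longrightarrow> (\<integral>\<^sup>+x. ennreal (f k x) \<partial>M) \<le> ennreal (b k)"
    by (auto simp: eventually_sequentially)
  have b_finite: "(\<Sum>k. ennreal (b (k + K))) \<noteq> \<infinity>"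
    unfolding infinity_ennreal_def
    by (intro ennreal_suminf_neq_top summable_ignore_initial_segment b)
  have "(\<integral>\<^sup>+x. (\<Sum>k. ennreal (f (k + K) x)) \<partial>M) = (\<Sum>k. \<integral>\<^sup>+x. ennreal (f (k + K) x) \<partial>M)"
    by (rule nn_integral_suminf) measurable
  also have "\<dots> \<le> (\<Sum>k. ennreal (b (k + K)))"
    by (intro suminf_le K) auto
  finally have "(\<integral>\<^sup>+x. (\<Sum>k. ennreal (f (k + K) x)) \<partial>M) \<noteq> \<infinity>"
    using b_finite by (auto simp: top_unique)
  then have "AE x in M. (\<Sum>k. ennreal (f (k + K) x)) \<noteq> \<infinity>"
    by (intro nn_integral_PInf_AE) auto
  then show ?thesis
  proof eventually_elim
    case (elim x)
    then have "summable (\<lambda>k. f (k + K) x)"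
      by (intro summable_suminf_not_top nonneg) auto
    then show ?case
      by (rule LIMSEQ_offset[OF summable_LIMSEQ_zero])
  qed
qed

section \<open>Almost sure convergence along the sequences \<open>2 ^ k * c\<close>\<close>

lemma summable_dyadic:
  fixes \<psi> :: "nat \<Rightarrow> real"
  assumes nonneg: "\<And>N. N \<ge> 1 \<Longrightarrow> \<psi> N \<ge> 0" and anti: "antimono_on {1..} \<psi>"
    and sum: "summable (\<lambda>n. \<psi> (Suc n) / real (Suc n))"
  shows "summable (\<lambda>k. \<psi> (2 ^ k))"
proof -
  let ?f = "\<lambda>n. \<psi> n / real n"
  \<comment> \<open>At \<open>n = 0\<close> the quotient is 0 by convention, whatever
    \<open>\<psi> 0\<close> is.\<close>
  have nn: "?f n \<ge> 0" for n
    using nonneg[of n] by (cases "n = 0") auto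
  have "?f (Suc m) \<le> ?f m" if "0 < m" for m
    using that nonneg[of m] nonneg[of "Suc m"]
    by (intro frac_le monotone_onD[OF anti]) auto
  \<comment> \<open>Cauchy condensation: the factor \<open>2 ^ k\<close> cancels the denominator of
    \<open>?f (2 ^ k)\<close>.\<close>
  then have "summable ?f \<longleftrightarrow> summable (\<lambda>k. 2 ^ k * ?f (2 ^ k))"
    by (intro condensation_test nn)
  then show ?thesis
    using sum by (simp add: summable_Suc_iff[of ?f, symmetric])
qed

text \<open>Along such a sparse sequence the variances are summable, so the deviation from the mean
  tends to 0 almost everywhere, while the mean tends to \<open>2 * s\<close>.\<close>

lemma AE_pair_count_dyadic:
  fixes \<psi> :: "nat \<Rightarrow> real"
  assumes A: "infinite A" and nonneg: "\<And>N. N \<ge> 1 \<Longrightarrow> \<psi> N \<ge> 0" and anti: "antimono_on {1..} \<psi>"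
    and sum: "summable (\<lambda>n. \<psi> (Suc n) / real (Suc n))"
    and energy: "(\<lambda>N. real (additive_energy (first_elems A N))) \<in> O(\<lambda>N. real N ^ 3 * \<psi> N)"
    and s: "s > 0" and c: "c \<ge> 1"
  shows "AE (x, y) in torus. (\<lambda>k. pair_count x y s (2 ^ k * c) A) \<longlonglongrightarrow> 2 * s"
proof -
  let ?N = "\<lambda>k. 2 ^ k * c"
  let ?f = "\<lambda>k (x, y). (pair_count x y s (?N k) A - 2 * s * (1 - 1 / real (?N k)))\<^sup>2"
  have lim: "filterlim ?N at_top sequentially"
  proof (rule filterlim_at_top_mono)
    show "filterlim (\<lambda>k::nat. k) at_top sequentially"
      by (rule filterlim_ident)
    have "k \<le> ?N k" for k
    proof -
      have "k \<le> 2 ^ k * 1"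
        by (simp add: less_imp_le)
      also have "\<dots> \<le> ?N k"
        using c by (intro mult_left_mono) auto
      finally show ?thesis .
    qed
    then show "eventually (\<lambda>k. k \<le> ?N k) sequentially"
      by simp
  qed
  from energy obtain C where C: "C > 0"
    "eventually (\<lambda>N. norm (real (additive_energy (first_elems A N))) \<le> C * norm (real N ^ 3 * \<psi> N)) at_top"
    by (elim landau_o.bigE)
  have "eventually (\<lambda>N. real N > 2 * s) at_top"
    using filterlim_real_sequentially by (simp add: filterlim_at_top_dense)
  with C(2) have "eventually (\<lambda>N. real (additive_energy (first_elems A N)) \<le> C * (real N ^ 3 * \<bar>\<psi> N\<bar>)
      \<and> real N > 2 * s) at_top"
    by eventually_elim (simp add: abs_mult)
  then have "eventually (\<lambda>k. real (additive_energy (first_elems A (?N k))) \<le> C * (real (?N k) ^ 3 * \<bar>\<psi> (?N k)\<bar>)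
      \<and> real (?N k) > 2 * s) sequentially"
    using lim by (rule eventually_compose_filterlim)
  then have "eventually (\<lambda>k. (\<integral>\<^sup>+p. ennreal (?f k p) \<partial>torus) \<le> ennreal (2 * s * C * \<psi> (2 ^ k))) sequentially"
  proof eventually_elim
    case (elim k)
    have N0: "real (?N k) > 0"
      using c by simp
    \<comment> \<open>Since \<open>c \<ge> 1\<close>, the bound can be stated through
      \<open>\<psi> (2 ^ k)\<close>, the same summable series for every \<open>c\<close>.\<close>
    have mono: "\<psi> (?N k) \<le> \<psi> (2 ^ k)"
      using c by (intro monotone_onD[OF anti]) auto
    have "real (additive_energy (first_elems A (?N k))) / real (?N k) ^ 3 \<le> C * \<bar>\<psi> (?N k)\<bar>"
      using elim N0 by (subst pos_divide_le_eq) (auto simp: mult_ac)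
    also have "\<dots> \<le> C * \<psi> (2 ^ k)"
      using mono C(1) c nonneg[of "?N k"] by (intro mult_left_mono) auto
    finally have "2 * s * (real (additive_energy (first_elems A (?N k))) / real (?N k) ^ 3)
        \<le> 2 * s * (C * \<psi> (2 ^ k))"
      using s by (intro mult_left_mono) auto
    then have "2 * s * (real (additive_energy (first_elems A (?N k))) / real (?N k) ^ 3)
        \<le> 2 * s * C * \<psi> (2 ^ k)"
      by (simp only: mult.assoc)
    moreover have "(\<integral>\<^sup>+p. ennreal (?f k p) \<partial>torus)
        \<le> ennreal (2 * s * (real (additive_energy (first_elems A (?N k))) / real (?N k) ^ 3))"
      using second_moment_pair_count[OF A s conjunct2[OF elim]] by (simp only: case_prod_unfold)
    ultimately show ?case
      using ennreal_leI order_trans by blast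
  qed
  moreover have "summable (\<lambda>k. 2 * s * C * \<psi> (2 ^ k))"
    by (intro summable_mult summable_dyadic nonneg anti sum)
  ultimately have "AE p in torus. (\<lambda>k. ?f k p) \<longlonglongrightarrow> 0"
    using C(1) s nonneg
    by (intro AE_tendsto_0_if_summable_nn_integral[where b = "\<lambda>k. 2 * s * C * \<psi> (2 ^ k)"]) auto
  then show ?thesis
  proof eventually_elim
    case (elim p)
    obtain x y where p: "p = (x, y)"
      by (cases p)
    have "(\<lambda>k. sqrt (?f k p)) \<longlonglongrightarrow> sqrt 0"
      by (intro tendsto_real_sqrt elim)
    then have "(\<lambda>k. \<bar>pair_count x y s (?N k) A - 2 * s * (1 - 1 / real (?N k))\<bar>) \<longlonglongrightarrow> 0"
      by (simp only: p prod.case real_sqrt_abs real_sqrt_zero)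
    then have diff: "(\<lambda>k. pair_count x y s (?N k) A - 2 * s * (1 - 1 / real (?N k))) \<longlonglongrightarrow> 0"
      by (rule tendsto_rabs_zero_cancel)
    have "((\<lambda>N. 2 * s * (1 - 1 / real N)) \<longlongrightarrow> 2 * s * (1 - 0)) at_top"
      by (intro tendsto_intros lim_1_over_n)
    then have "(\<lambda>k. 2 * s * (1 - 1 / real (?N k))) \<longlonglongrightarrow> 2 * s"
      unfolding diff_zero mult_1_right using lim by (rule filterlim_compose)
    from tendsto_add[OF diff this] show ?case
      unfolding p by simp
  qed
qed

section \<open>Interpolation between the sequences \<open>2 ^ k * c\<close>\<close>

lemma pair_count_nonneg: "pair_count x y s N A \<ge> 0"
  by (simp add: pair_count_def)

text \<open>More indices and a wider window can only add pairs; the factors \<open>N\<close> and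
  \<open>M\<close> undo the normalisation.\<close>

lemma pair_count_mono:
  assumes "1 \<le> N" "N \<le> M" "s / real N \<le> t / real M"
  shows "real N * pair_count x y s N A \<le> real M * pair_count x y t M A"
proof -
  let ?S = "\<lambda>s N. {(i, j). i \<in> {1..N} \<and> j \<in> {1..N} \<and> i \<noteq> j \<and>
    circle_norm (real (nth_elem A i) * x - real (nth_elem A j) * x - y) \<le> s / real N}"
  have "finite (?S t M)"
    by (rule finite_subset[of _ "{1..M} \<times> {1..M}"]) auto
  moreover have "?S s N \<subseteq> ?S t M"
    using assms by auto
  ultimately have "card (?S s N) \<le> card (?S t M)"
    by (rule card_mono)
  then show ?thesis
    using assms by (simp add: pair_count_def)
qed

text \<open>The scale \<open>k\<close> is the last one with \<open>2 ^ k * m \<le> N\<close>, and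
  \<open>c\<close> is \<open>N div 2 ^ k\<close>. Thus \<open>c\<close> ranges over a finite set
  that depends only on \<open>m\<close>.\<close>

lemma dyadic_block:
  fixes K m N :: nat
  assumes m: "1 \<le> m" and N: "2 ^ K * m \<le> N"
  obtains k c where "K \<le> k" "m \<le> c" "c < 2 * m" "2 ^ k * c \<le> N" "N < 2 ^ k * (c + 1)"
proof -
  define k' where "k' = (LEAST k. N < 2 ^ k * m)"
  have "N < 2 ^ N * 1"
    by simp
  also have "\<dots> \<le> 2 ^ N * m"
    using m by (intro mult_left_mono) auto
  finally have k': "N < 2 ^ k' * m"
    unfolding k'_def by (rule LeastI)
  have "K < k'"
  proof (rule ccontr)
    assume "\<not> K < k'"
    then have "2 ^ k' * m \<le> 2 ^ K * m"
      by (intro mult_right_mono power_increasing) auto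
    with k' N show False by linarith
  qed
  then obtain k where k: "k' = Suc k" "K \<le> k"
    by (cases k') auto
  have "\<not> N < 2 ^ k * m"
    using k(1) unfolding k'_def by (intro not_less_Least) simp
  then have "m \<le> N div 2 ^ k"
    by (simp add: less_eq_div_iff_mult_less_eq mult.commute)
  moreover have "N div 2 ^ k < 2 * m"
    using k' k(1) by (intro less_mult_imp_div_less) (simp add: mult_ac)
  moreover have "2 ^ k * (N div 2 ^ k) \<le> N"
    by simp
  moreover have "N < 2 ^ k * (N div 2 ^ k + 1)"
    using dividend_less_times_div[of "2 ^ k" N] by simp
  ultimately show thesis
    using that k(2) by blast
qed

text \<open>The factor \<open>1 + 1 / m\<close> tends to 1, so a strict inequality survives it for
  large \<open>m\<close>; \<open>a\<close> may have any sign.\<close>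

lemma eventually_dilate_less:
  fixes a b :: real
  assumes "a < b"
  shows "eventually (\<lambda>m. (1 + 1 / real m) * a < b) sequentially"
proof (rule order_tendstoD)
  have "(\<lambda>m. (1 + 1 / real m) * a) \<longlonglongrightarrow> (1 + 0) * a"
    by (intro tendsto_intros lim_1_over_n)
  then show "(\<lambda>m. (1 + 1 / real m) * a) \<longlonglongrightarrow> a"
    by simp
qed (rule assms)

text \<open>The ends of a block have ratio \<open>1 + 1 / c\<close>, at most
  \<open>1 + 1 / m\<close>, and \<open>N\<close> lies between them.\<close>

lemma dyadic_block_bounds:
  fixes k c m N :: nat
  assumes "1 \<le> m" "m \<le> c" "2 ^ k * c \<le> N" "N < 2 ^ k * (c + 1)"
  shows "real (2 ^ k * (c + 1)) \<le> (1 + 1 / real m) * real N"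
    and "real N \<le> (1 + 1 / real m) * real (2 ^ k * c)"
proof -
  have "real (2 ^ k * (c + 1)) = (1 + 1 / real c) * real (2 ^ k * c)"
    using assms by (simp add: field_simps)
  also have "\<dots> \<le> (1 + 1 / real m) * real (2 ^ k * c)"
    using assms by (intro mult_right_mono add_left_mono frac_le) auto
  finally have *: "real (2 ^ k * (c + 1)) \<le> (1 + 1 / real m) * real (2 ^ k * c)" .
  have "real N \<le> real (2 ^ k * (c + 1))"
    using assms(4) by (intro of_nat_mono) simp
  also note *
  finally show "real N \<le> (1 + 1 / real m) * real (2 ^ k * c)" .
  note *
  also have "(1 + 1 / real m) * real (2 ^ k * c) \<le> (1 + 1 / real m) * real N"
    using assms(3) by (intro mult_left_mono of_nat_mono) auto
  finally show "real (2 ^ k * (c + 1)) \<le> (1 + 1 / real m) * real N" .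
qed

lemma divide_le_divideI:
  fixes a b :: real
  shows "0 < a \<Longrightarrow> 0 < b \<Longrightarrow> s * b \<le> r * a \<Longrightarrow> s / a \<le> r / b"
  by (simp add: field_simps)

text \<open>Compares \<open>N\<close> with the upper end of its block at a rational
  \<open>r > s\<close>, and with the lower end at a rational \<open>r < s\<close>. The gap between
  \<open>r\<close> and \<open>s\<close> absorbs the change of window width caused by the change of
  \<open>N\<close>.\<close>

lemma pair_count_tendsto_from_dyadic:
  assumes lim: "\<And>r c. r \<in> \<rat> \<Longrightarrow> r > 0 \<Longrightarrow> c \<ge> 1 \<Longrightarrow>
      (\<lambda>k. pair_count x y r (2 ^ k * c) A) \<longlonglongrightarrow> 2 * r"
    and s: "s > 0"
  shows "(\<lambda>N. pair_count x y s N A) \<longlonglongrightarrow> 2 * s"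
proof (rule order_tendstoI)
  let ?F = "\<lambda>s N. pair_count x y s N A"
  fix u assume "2 * s < u"
  then have "s < u / 2" by simp
  then obtain r where r: "r \<in> \<rat>" "s < r" "r < u / 2"
    using Rats_dense_in_real by blast
  \<comment> \<open>One \<open>m\<close> must serve twice: for the comparison of windows and for the
    final loss by the factor \<open>q\<close>.\<close>
  have "eventually (\<lambda>m. (1 + 1 / real m) * s < r \<and> (1 + 1 / real m) * (2 * r) < u \<and> 1 \<le> m) sequentially"
    using r by (intro eventually_conj eventually_dilate_less eventually_ge_at_top) simp_all
  from eventually_happens'[OF sequentially_bot this]
  obtain m where m: "(1 + 1 / real m) * s < r" "(1 + 1 / real m) * (2 * r) < u" "1 \<le> m"
    by blast
  define q where "q = 1 + 1 / real m"
  have q: "q > 0"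
    by (simp add: q_def add_pos_nonneg)
  \<comment> \<open>Only finitely many \<open>c\<close> occur for fixed \<open>m\<close>, so one
    threshold \<open>K\<close> works for all of them.\<close>
  have "eventually (\<lambda>k. \<forall>c\<in>{m..<2*m}. ?F r (2 ^ k * (c + 1)) < u / q) sequentially"
  proof (intro eventually_ball_finite ballI order_tendstoD(2)[OF lim])
    show "2 * r < u / q"
      using m(2) q by (simp only: pos_less_divide_eq q_def[symmetric] mult.commute[of q])
  qed (use r s in auto)
  then obtain K where K: "\<And>k c. k \<ge> K \<Longrightarrow> c \<in> {m..<2*m} \<Longrightarrow> ?F r (2 ^ k * (c + 1)) < u / q"
    unfolding eventually_sequentially by blast
  have "?F s N < u" if "2 ^ K * m \<le> N" for N
  proof -
    from dyadic_block[OF m(3) that] obtain k c where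
      kc: "K \<le> k" "m \<le> c" "c < 2 * m" "2 ^ k * c \<le> N" "N < 2 ^ k * (c + 1)" .
    define H where "H = 2 ^ k * (c + 1)"
    have H0: "real H > 0"
      by (simp add: H_def add_pos_nonneg)
    have N0: "real N > 0"
      using kc(2,4) m(3) by (cases N) auto
    have HN: "real H \<le> q * real N"
      using dyadic_block_bounds(1)[OF m(3) kc(2,4,5)] by (simp only: q_def H_def)
    \<comment> \<open>The window \<open>r / H\<close> is at least as wide as \<open>s / N\<close>,
      because \<open>q * s < r\<close>.\<close>
    have "s * real H \<le> s * (q * real N)"
      using s HN by (intro mult_left_mono) auto
    also have "\<dots> \<le> r * real N"
      unfolding mult.assoc[symmetric] mult.commute[of s] q_def
      using m(1) N0 by (intro mult_right_mono) auto
    finally have "s / real N \<le> r / real H"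
      by (rule divide_le_divideI[OF N0 H0])
    then have "real N * ?F s N \<le> real H * ?F r H"
      using kc N0 by (intro pair_count_mono) (auto simp: H_def)
    also have "\<dots> \<le> q * real N * ?F r H"
      using HN by (intro mult_right_mono pair_count_nonneg)
    finally have "?F s N \<le> q * ?F r H"
      using N0 by (simp only: mult.assoc mult.left_commute[of q] mult_le_cancel_left_pos)
    also have "?F r H < u / q"
      using K[of k c] kc by (simp add: H_def add_pos_nonneg)
    then have "q * ?F r H < u"
      using q by (simp only: pos_less_divide_eq mult.commute)
    finally show ?thesis .
  qed
  then show "eventually (\<lambda>N. ?F s N < u) sequentially"
    unfolding eventually_sequentially by blast
next
  let ?F = "\<lambda>s N. pair_count x y s N A"
  fix l assume "l < 2 * s"
  \<comment> \<open>The maximum with 0 keeps \<open>r\<close> positive even if \<open>l\<close> is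
    negative.\<close>
  with s have "max 0 (l / 2) < s" by simp
  then obtain r where r: "r \<in> \<rat>" "max 0 (l / 2) < r" "r < s"
    using Rats_dense_in_real by blast
  have "eventually (\<lambda>m. (1 + 1 / real m) * r < s \<and> (1 + 1 / real m) * l < 2 * r \<and> 1 \<le> m) sequentially"
    using r by (intro eventually_conj eventually_dilate_less eventually_ge_at_top) simp_all
  from eventually_happens'[OF sequentially_bot this]
  obtain m where m: "(1 + 1 / real m) * r < s" "(1 + 1 / real m) * l < 2 * r" "1 \<le> m"
    by blast
  define q where "q = 1 + 1 / real m"
  have q: "q > 0"
    by (simp add: q_def add_pos_nonneg)
  have "eventually (\<lambda>k. \<forall>c\<in>{m..<2*m}. q * l < ?F r (2 ^ k * c)) sequentially"
  proof (intro eventually_ball_finite ballI order_tendstoD(1)[OF lim])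
    show "q * l < 2 * r"
      using m(2) by (simp only: q_def)
  qed (use r m in auto)
  then obtain K where K: "\<And>k c. k \<ge> K \<Longrightarrow> c \<in> {m..<2*m} \<Longrightarrow> q * l < ?F r (2 ^ k * c)"
    unfolding eventually_sequentially by blast
  have "l < ?F s N" if "2 ^ K * m \<le> N" for N
  proof -
    from dyadic_block[OF m(3) that] obtain k c where
      kc: "K \<le> k" "m \<le> c" "c < 2 * m" "2 ^ k * c \<le> N" "N < 2 ^ k * (c + 1)" .
    define L where "L = 2 ^ k * c"
    have L0: "real L > 0"
      using kc(2) m(3) by (simp add: L_def)
    then have N0: "real N > 0"
      using kc(4) unfolding L_def by linarith
    have LN: "real N \<le> q * real L"
      using dyadic_block_bounds(2)[OF m(3) kc(2,4,5)] by (simp only: q_def L_def)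
    \<comment> \<open>Now the window \<open>r / L\<close> at the lower end is at most
      \<open>s / N\<close>, because \<open>q * r < s\<close>.\<close>
    have "r * real N \<le> r * (q * real L)"
      using r LN by (intro mult_left_mono) auto
    also have "\<dots> \<le> s * real L"
      unfolding mult.assoc[symmetric] mult.commute[of r] q_def
      using m(1) L0 by (intro mult_right_mono) auto
    finally have "r / real L \<le> s / real N"
      by (rule divide_le_divideI[OF L0 N0])
    then have "real L * ?F r L \<le> real N * ?F s N"
      using kc L0 by (intro pair_count_mono) (auto simp: L_def)
    also have "\<dots> \<le> q * real L * ?F s N"
      using LN by (intro mult_right_mono pair_count_nonneg)
    finally have "?F r L \<le> q * ?F s N"
      using L0 by (simp only: mult.assoc mult.left_commute[of q] mult_le_cancel_left_pos)
    moreover have "q * l < ?F r L"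
      using K[of k c] kc by (simp add: L_def)
    ultimately have "q * l < q * ?F s N"
      by linarith
    then show ?thesis
      using q by simp
  qed
  then show "eventually (\<lambda>N. l < ?F s N) sequentially"
    unfolding eventually_sequentially by blast
qed

theorem theorem2p2:
  fixes A :: "nat set" and \<psi> :: "nat \<Rightarrow> real"
  assumes "A \<subseteq> {1..}" and "infinite A"
    and "\<And>N. N \<ge> 1 \<Longrightarrow> \<psi> N \<in> {0..1}"
    and "antimono_on {1..} \<psi>"
    and "summable (\<lambda>n. \<psi> (Suc n) / real (Suc n))"
    and "(\<lambda>N. real (additive_energy (first_elems A N))) \<in> O(\<lambda>N. real N ^ 3 * \<psi> N)"
  shows "doubly_metric_poissonian A"
proof -
  let ?P = "\<lambda>r c (x, y). (\<lambda>k. pair_count x y r (2 ^ k * c) A) \<longlonglongrightarrow> 2 * r"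
  have nonneg: "\<psi> N \<ge> 0" if "N \<ge> 1" for N
    using assms(3)[OF that] by simp
  \<comment> \<open>The conditions on \<open>r\<close> and \<open>c\<close> are moved inside, so
    that the statement holds for all \<open>r\<close> and \<open>c\<close> and can be quantified
    over countable sets.\<close>
  have dyadic: "AE p in torus. r > 0 \<longrightarrow> c \<ge> 1 \<longrightarrow> ?P r c p" for r c
    using AE_pair_count_dyadic[OF assms(2) nonneg assms(4-6), of r c]
    by (cases "r > 0 \<and> c \<ge> 1") auto
  \<comment> \<open>A countable union of null sets is null; outside it, the interpolation treats
    every real \<open>s\<close> pointwise.\<close>
  have "AE p in torus. \<forall>r\<in>\<rat>. \<forall>c\<in>UNIV. r > 0 \<longrightarrow> c \<ge> 1 \<longrightarrow> ?P r c p"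
    by (intro AE_ball_countable[THEN iffD2] ballI countable_rat countableI_type dyadic)
  then have "AE p in torus. \<forall>s>0. case p of (x, y) \<Rightarrow> (\<lambda>N. pair_count x y s N A) \<longlonglongrightarrow> 2 * s"
    by eventually_elim (auto intro!: pair_count_tendsto_from_dyadic)
  then have "AE p in torus. case p of (x, y) \<Rightarrow> \<forall>s>0. (\<lambda>N. pair_count x y s N A) \<longlonglongrightarrow> 2 * s"
    by eventually_elim auto
  then show ?thesis
    unfolding doubly_metric_poissonian_def by (rule AE_torus_imp_AE_lebesgue_on)
qed

end
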